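(* Let $n\ge 1$, let $b\ge 0$ be a locally integrable function on $\mathbb{R}^n$, let $0<\beta<1$ and suppose $b\in\dot{\Lambda}_{\beta}(\mathbb{R}^n)$. Then there is a positive constant $C$ such that for all $f\in L^1(\mathbb{R}^n)$ and all $\lambda>0$, $$\big|\{x\in\mathbb{R}^n: |[b,M](f)(x)|>\lambda\}\big| \le C\big(\lambda^{-1}\|f\|_{L^1(\mathbb{R}^n)}\big)^{n/(n-\beta)}.$$
   Context: Cubes have sides parallel to the coordinate axes; $|E|$ denotes Lebesgue measure. The Hardy-Littlewood maximal function is $$M(f)(x)=\sup_{Q\ni x}\frac{1}{|Q|}\int_Q|f(y)|\,dy,$$ the supremum being over all cubes $Q\subset\mathbb{R}^n$ containing $x$. For a locally integrable function $b$, the (nonlinear) commutator is $$[b,M](f)(x)=b(x)M(f)(x)-M(bf)(x),$$ considered at almost every $x$ (where the terms are finite). For $0<\beta<1$, a function $b$ belongs to the Lipschitz space $\dot{\Lambda}_{\beta}(\mathbb{R}^n)$ if there is a constant $C$ such that $|b(x)-b(y)|\le C|x-y|^{\beta}$ for all $x,y\in\mathbb{R}^n$. As usual, functions are identified if they agree almost everywhere. *)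

theory Defs
  imports "HOL-Analysis.Analysis"
begin

(* Cubes are closed and nondegenerate; taking open cubes instead gives the same maximal function. *)
definition cubes :: "(real ^ 'n) set set" where
  "cubes = {cbox a (\<chi> i. a $ i + r) | a r. 0 < r}"

definition maximal :: "(real ^ 'n \<Rightarrow> real) \<Rightarrow> real ^ 'n \<Rightarrow> ennreal" where
  "maximal f x =
     (SUP Q \<in> {Q \<in> cubes. x \<in> Q}. (\<integral>\<^sup>+ y\<in>Q. ennreal \<bar>f y\<bar> \<partial>lebesgue) / emeasure lebesgue Q)"

(* The commutator is extended-real valued: where both terms are infinite it equals \<infinity>, since
   \<infinity> - \<infinity> = \<infinity> in ereal.  Hence such points belong to every set {x. |[b,M](f)(x)| > t}
   instead of being silently dropped from it. *)
definition commutator ::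
    "(real ^ 'n \<Rightarrow> real) \<Rightarrow> (real ^ 'n \<Rightarrow> real) \<Rightarrow> real ^ 'n \<Rightarrow> ereal" where
  "commutator b f x =
     ereal (b x) * enn2ereal (maximal f x) - enn2ereal (maximal (\<lambda>y. b y * f y) x)"

definition locally_integrable :: "(real ^ 'n \<Rightarrow> real) \<Rightarrow> bool" where
  "locally_integrable b \<longleftrightarrow> (\<forall>K. compact K \<longrightarrow> set_integrable lebesgue K b)"

(* Functions are identified if they agree almost everywhere, so membership means that some
   representative satisfies the Lipschitz condition. *)
definition lipschitz_space :: "real \<Rightarrow> (real ^ 'n \<Rightarrow> real) set" where
  "lipschitz_space \<beta> =
     {b. \<exists>b'. (AE x in lebesgue. b x = b' x) \<and>
          (\<exists>C. \<forall>x y. \<bar>b' x - b' y\<bar> \<le> C * norm (x - y) powr \<beta>)}"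

end

theory Submission
  imports Defs
begin

text \<open>Where \<open>M f\<close> is finite, the Hoelder bound on \<open>b\<close> over a cube of side \<open>r\<close> gives
  \<open>\<bar>[b,M] f\<bar> \<le> C M\<^sub>\<beta> f\<close>, with the fractional maximal function
  \<open>M\<^sub>\<beta> f x = sup r\<^bsup>\<beta>-n\<^esup> \<integral>\<^bsub>Q\<^esub> \<bar>f\<bar>\<close> over the cubes \<open>Q\<close> of side \<open>r\<close> containing \<open>x\<close>.
  The Vitali covering lemma shows that \<open>M\<^sub>\<beta>\<close> is of weak type \<open>(1, n/(n-\<beta>))\<close>; its case
  \<open>\<beta> = 0\<close> shows that \<open>M f\<close> is finite almost everywhere.\<close>

section \<open>Geometry of cubes and balls\<close>

abbreviation cube :: "real ^ 'n \<Rightarrow> real \<Rightarrow> (real ^ 'n) set" where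
  "cube a r \<equiv> cbox a (\<chi> i. a $ i + r)"

lemma measure_cube:
  fixes a :: "real ^ 'n"
  assumes "0 \<le> r"
  shows "measure lebesgue (cube a r) = r ^ CARD('n)"
proof -
  have "a \<in> cube a r" using assms by (simp add: mem_box_cart)
  then have "cube a r \<noteq> {}" by blast
  then show ?thesis by (simp add: content_cbox_cart)
qed

lemma emeasure_cube:
  fixes a :: "real ^ 'n"
  assumes "0 \<le> r"
  shows "emeasure lebesgue (cube a r) = ennreal (r ^ CARD('n))"
  by (simp only: emeasure_eq_measure2[OF lmeasurable_cbox] measure_cube[OF assms])

text \<open>Each coordinate of \<open>x - y\<close> is at most \<open>r\<close>, and the Euclidean
  norm is at most the sum of the coordinates. The factor \<open>CARD('n)\<close> instead of its
  square root only enlarges the constants.\<close>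

lemma norm_diff_le_in_cube:
  fixes a :: "real ^ 'n"
  assumes "x \<in> cube a r" "y \<in> cube a r"
  shows "norm (x - y) \<le> real CARD('n) * r"
proof -
  have "\<bar>(x - y) $ i\<bar> \<le> r" for i
  proof -
    have "a $ i \<le> x $ i \<and> x $ i \<le> a $ i + r" "a $ i \<le> y $ i \<and> y $ i \<le> a $ i + r"
      using assms by (simp_all add: mem_box_cart)
    then show ?thesis by (auto simp: abs_le_iff)
  qed
  then have "(\<Sum>i\<in>UNIV. \<bar>(x - y) $ i\<bar>) \<le> real CARD('n) * r"
    using sum_bounded_above[of UNIV "\<lambda>i. \<bar>(x - y) $ i\<bar>" r] by simp
  then show ?thesis using norm_le_l1_cart[of "x - y"] by linarith
qed

lemma measure_cball_le:
  fixes x :: "real ^ 'n"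
  assumes "0 \<le> r"
  shows "measure lebesgue (cball x r) \<le> (2 * r) ^ CARD('n)"
proof -
  have "cball x r \<subseteq> cube (\<chi> i. x $ i - r) (2 * r)"
  proof
    fix y assume "y \<in> cball x r"
    then have "norm (x - y) \<le> r" by (simp add: dist_norm)
    then have "\<bar>x $ i - y $ i\<bar> \<le> r" for i
      using component_le_norm_cart[of "x - y" i] by simp
    then show "y \<in> cube (\<chi> i. x $ i - r) (2 * r)"
      by (simp add: mem_box_cart abs_le_iff) (smt (verit))
  qed
  then have "measure lebesgue (cball x r) \<le> measure lebesgue (cube (\<chi> i. x $ i - r) (2 * r))"
    by (intro measure_mono_fmeasurable) auto
  then show ?thesis using assms by (subst (asm) measure_cube) auto
qed

section \<open>Weak-type estimate for the fractional maximal function\<close>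

lemma set_integral_abs_le_integral:
  fixes f :: "'a \<Rightarrow> real"
  assumes "integrable M f" "A \<in> sets M"
  shows "(LINT y:A|M. \<bar>f y\<bar>) \<le> (LINT y|M. \<bar>f y\<bar>)"
  unfolding set_lebesgue_integral_def
  using assms by (intro integral_mono integrable_mult_indicator integrable_abs)
    (auto simp: indicator_def)

text \<open>The set on the left of the inclusion is where the fractional maximal function of order
  \<open>\<alpha>\<close> exceeds \<open>t\<close>; enclosing it in a measurable \<open>U\<close>
  avoids arguing about its own measurability. Every cube that witnesses membership has a volume
  controlled by its share of the mass of \<open>f\<close>, and over disjoint cubes these shares add
  up to at most the whole norm.\<close>

lemma fractional_maximal_weak_type:
  fixes f :: "real ^ 'n \<Rightarrow> real"
  assumes f: "integrable lebesgue f" and \<alpha>: "0 \<le> \<alpha>" "\<alpha> < real CARD('n)" and t: "0 < t"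
  obtains U where "U \<in> lmeasurable"
    "{x. \<exists>a r. 0 < r \<and> x \<in> cube a r \<and>
        r powr (real CARD('n) - \<alpha>) * t < (LINT y:cube a r|lebesgue. \<bar>f y\<bar>)} \<subseteq> U"
    "measure lebesgue U \<le> (10 * real CARD('n)) ^ CARD('n) *
        (inverse t * (LINT x|lebesgue. \<bar>f x\<bar>)) powr (real CARD('n) / (real CARD('n) - \<alpha>))"
proof -
  define n where "n = real CARD('n)"
  define d where "d = n - \<alpha>"
  define p where "p = n / d"
  define I where "I Q = inverse t * (LINT y:Q|lebesgue. \<bar>f y\<bar>)" for Q :: "(real ^ 'n) set"
  define A where "A = inverse t * (LINT x|lebesgue. \<bar>f x\<bar>)"
  define E where "E = {x :: real ^ 'n. \<exists>a r. 0 < r \<and> x \<in> cube a r \<and>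
        r powr d * t < (LINT y:cube a r|lebesgue. \<bar>f y\<bar>)}"
  have n: "n \<ge> 1" unfolding n_def by (simp add: Suc_leI)
  have d: "d > 0" using \<alpha> by (simp add: d_def n_def)
  have p: "p \<ge> 1" using d \<alpha> by (simp add: p_def d_def field_simps)
  have A0: "A \<ge> 0" using t by (simp add: A_def)
  have IA: "I Q \<le> A" if "Q \<in> sets lebesgue" for Q
    unfolding I_def A_def using t set_integral_abs_le_integral[OF f that]
    by (intro mult_left_mono) auto
  have "\<forall>x\<in>E. \<exists>a r. 0 < r \<and> x \<in> cube a r \<and> r powr d < I (cube a r)"
  proof
    fix x assume "x \<in> E"
    then obtain a r where ar: "0 < r" "x \<in> cube a r"
      "r powr d * t < (LINT y:cube a r|lebesgue. \<bar>f y\<bar>)"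
      unfolding E_def by blast
    then have "r powr d < I (cube a r)" using t by (simp add: I_def field_simps)
    with ar show "\<exists>a r. 0 < r \<and> x \<in> cube a r \<and> r powr d < I (cube a r)" by blast
  qed
  then obtain a r where ar: "\<And>x. x \<in> E \<Longrightarrow> 0 < r x"
      "\<And>x. x \<in> E \<Longrightarrow> x \<in> cube (a x) (r x)"
      "\<And>x. x \<in> E \<Longrightarrow> r x powr d < I (cube (a x) (r x))"
    by metis
  define Q where "Q x = cube (a x) (r x)" for x
  have Qs: "Q x \<in> sets lebesgue" for x unfolding Q_def by simp
  have IQ: "r x powr d < I (Q x)" if "x \<in> E" for x using ar(3)[OF that] by (simp add: Q_def)
  \<comment> \<open>The covering lemma asks for uniformly bounded radii; the total mass
    \<open>A\<close> bounds the side of every chosen cube.\<close>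
  have rA: "r x \<le> A powr (1 / d)" if "x \<in> E" for x
  proof -
    have "r x powr d \<le> A" using IQ[OF that] IA[OF Qs, of x] by linarith
    then have "(r x powr d) powr (1 / d) \<le> A powr (1 / d)"
      using d by (intro powr_mono2) auto
    then show ?thesis using d ar(1)[OF that] by (simp add: powr_powr)
  qed
  \<comment> \<open>One factor \<open>I (Q x)\<close> is split off from
    \<open>I (Q x) powr p\<close> and the others are estimated by \<open>A\<close>. The bound is
    then linear in \<open>I (Q x)\<close>, so it can be summed over disjoint cubes.\<close>
  have rpow: "r x ^ CARD('n) \<le> I (Q x) * A powr (p - 1)" if "x \<in> E" for x
  proof -
    have r0: "r x > 0" using ar(1) that by blast
    have I0: "I (Q x) > 0" using IQ[OF that] powr_ge_zero[of "r x" d] by linarith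
    have "r x ^ CARD('n) = (r x powr d) powr p"
      using d r0 by (simp add: powr_powr p_def n_def powr_realpow)
    also have "\<dots> \<le> I (Q x) powr p"
      using IQ[OF that] p by (intro powr_mono2) auto
    also have "\<dots> = I (Q x) * I (Q x) powr (p - 1)"
      using I0 by (simp add: powr_diff)
    also have "\<dots> \<le> I (Q x) * A powr (p - 1)"
      using I0 p IA[OF Qs] by (intro mult_left_mono powr_mono2) auto
    finally show ?thesis .
  qed
  \<comment> \<open>The balls are centred at the points of \<open>E\<close>, not at the centres of
    the cubes, so the radius has to bound the whole diameter of the cube.\<close>
  have Qball: "Q x \<subseteq> cball x (n * r x)" if "x \<in> E" for x
    using norm_diff_le_in_cube[OF ar(2)[OF that]] unfolding Q_def n_def
    by (auto simp: dist_norm)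
  have EK: "E \<subseteq> (\<Union>x\<in>E. cball x (n * r x))"
    using Qball ar(2) unfolding Q_def by blast
  have rb: "0 < n * r x \<and> n * r x \<le> n * A powr (1 / d)" if "x \<in> E" for x
    using ar(1)[OF that] rA[OF that] n by simp
  obtain C where C: "countable C" "C \<subseteq> E"
     "pairwise (\<lambda>i j. disjnt (cball i (n * r i)) (cball j (n * r j))) C"
     "E \<subseteq> (\<Union>i\<in>C. cball i (5 * (n * r i)))"
    by (rule Vitali_covering_lemma_cballs[of E "\<lambda>x. x" "\<lambda>x. n * r x" E, OF EK rb])
  define U where "U = (\<Union>i\<in>C. cball i (5 * (n * r i)))"
  \<comment> \<open>A bound for all finite subfamilies that does not depend on the subfamily yields
    both finite measure and the same bound for the countable union.\<close>
  have bound: "measure lebesgue (\<Union>i\<in>F. cball i (5 * (n * r i))) \<le> (10 * n) ^ CARD('n) * A powr p"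
    if F: "F \<subseteq> C" "finite F" for F
  proof -
    have FE: "x \<in> E" if "x \<in> F" for x using that F C by blast
    \<comment> \<open>The cubes inherit disjointness from the balls that contain them.\<close>
    have dis: "disjoint_family_on Q F"
      unfolding disjoint_family_on_def
    proof (intro ballI impI)
      fix x y assume "x \<in> F" "y \<in> F" "x \<noteq> y"
      then have "disjnt (cball x (n * r x)) (cball y (n * r y))"
        using C(3) F unfolding pairwise_def by blast
      then show "Q x \<inter> Q y = {}"
        using Qball[OF FE] \<open>x \<in> F\<close> \<open>y \<in> F\<close> unfolding disjnt_def by blast
    qed
    have "(\<Sum>x\<in>F. I (Q x)) = I (\<Union>x\<in>F. Q x)"
      unfolding I_def sum_distrib_left[symmetric]
      using dis Qs F f
      by (subst set_integral_finite_Union)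
         (auto simp: set_integrable_def intro!: integrable_mult_indicator[where f="\<lambda>y. \<bar>f y\<bar>", simplified])
    also have "\<dots> \<le> A" using Qs F by (intro IA sets.finite_UN) auto
    finally have sumI: "(\<Sum>x\<in>F. I (Q x)) \<le> A" .
    have "measure lebesgue (\<Union>i\<in>F. cball i (5 * (n * r i)))
        \<le> (\<Sum>i\<in>F. measure lebesgue (cball i (5 * (n * r i))))"
      using F by (intro measure_UNION_le) auto
    also have "\<dots> \<le> (\<Sum>i\<in>F. (10 * n) ^ CARD('n) * (I (Q i) * A powr (p - 1)))"
    proof (rule sum_mono)
      fix i assume i: "i \<in> F"
      \<comment> \<open>The constant 10 is 5 from the Vitali enlargement times 2 from enclosing a
        ball in a cube of twice its radius.\<close>
      have "measure lebesgue (cball i (5 * (n * r i))) \<le> (2 * (5 * (n * r i))) ^ CARD('n)"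
        using rb[OF FE[OF i]] by (intro measure_cball_le) simp
      also have "\<dots> = (10 * n) ^ CARD('n) * r i ^ CARD('n)"
        unfolding power_mult_distrib[of "10 * n" "r i", symmetric] by (simp add: mult.assoc)
      also have "\<dots> \<le> (10 * n) ^ CARD('n) * (I (Q i) * A powr (p - 1))"
        using rpow[OF FE[OF i]] n by (intro mult_left_mono) auto
      finally show "measure lebesgue (cball i (5 * (n * r i)))
        \<le> (10 * n) ^ CARD('n) * (I (Q i) * A powr (p - 1))" .
    qed
    also have "\<dots> = (10 * n) ^ CARD('n) * A powr (p - 1) * (\<Sum>i\<in>F. I (Q i))"
      unfolding sum_distrib_left by (intro sum.cong) (auto simp: mult_ac)
    also have "\<dots> \<le> (10 * n) ^ CARD('n) * A powr (p - 1) * A"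
      using sumI n by (intro mult_left_mono) auto
    \<comment> \<open>For \<open>A = 0\<close> both sides vanish, since \<open>0 powr p = 0\<close>;
      otherwise the exponents add up.\<close>
    also have "\<dots> = (10 * n) ^ CARD('n) * A powr p"
      using A0 p by (cases "A = 0") (auto simp: powr_diff)
    finally show ?thesis .
  qed
  show ?thesis
  proof
    show "U \<in> lmeasurable"
      unfolding U_def by (rule fmeasurable_UN_bound[OF C(1) _ bound]) auto
    have "measure lebesgue U \<le> (10 * n) ^ CARD('n) * A powr p"
      unfolding U_def by (rule measure_UN_bound[OF C(1) _ bound]) auto
    then show "measure lebesgue U \<le> (10 * real CARD('n)) ^ CARD('n) *
        (inverse t * (LINT x|lebesgue. \<bar>f x\<bar>)) powr (real CARD('n) / (real CARD('n) - \<alpha>))"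
      by (simp add: A_def p_def d_def n_def)
    show "{x. \<exists>a r. 0 < r \<and> x \<in> cube a r \<and>
        r powr (real CARD('n) - \<alpha>) * t < (LINT y:cube a r|lebesgue. \<bar>f y\<bar>)} \<subseteq> U"
      using C(4) by (simp add: E_def U_def d_def n_def)
  qed
qed

section \<open>Averages over cubes and finiteness of the maximal function\<close>

lemma nn_set_integral_abs:
  fixes f :: "'a \<Rightarrow> real"
  assumes "integrable M f" "Q \<in> sets M"
  shows "(\<integral>\<^sup>+ y\<in>Q. ennreal \<bar>f y\<bar> \<partial>M) = ennreal (LINT y:Q|M. \<bar>f y\<bar>)"
  using assms by (intro nn_set_integral_eq_set_integral) auto

lemma average_cube:
  fixes f :: "real ^ 'n \<Rightarrow> real"
  assumes "integrable lebesgue f" "0 < r"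
  shows "(\<integral>\<^sup>+ y\<in>cube a r. ennreal \<bar>f y\<bar> \<partial>lebesgue) / emeasure lebesgue (cube a r)
     = ennreal ((LINT y:cube a r|lebesgue. \<bar>f y\<bar>) / r ^ CARD('n))"
proof -
  have "0 \<le> (LINT y:cube a r|lebesgue. \<bar>f y\<bar>)"
    unfolding set_lebesgue_integral_def by (intro integral_nonneg_AE) auto
  then show ?thesis
    using assms
    by (simp add: nn_set_integral_abs emeasure_cube[OF less_imp_le] divide_ennreal
        del: emeasure_completion)
qed

text \<open>For order 0 the exponent is 1, so the superlevel set at height \<open>t\<close> is
  covered by a set of measure at most a constant divided by \<open>t\<close>. The points of infinite
  value lie in all superlevel sets, and \<open>t\<close> can be taken arbitrarily large.\<close>

lemma maximal_finite_AE:
  fixes f :: "real ^ 'n \<Rightarrow> real"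
  assumes f: "integrable lebesgue f"
  shows "AE x in lebesgue. maximal f x < \<infinity>"
proof -
  define A where "A = (LINT x|lebesgue. \<bar>f x\<bar>)"
  define K where "K = (10 * real CARD('n)) ^ CARD('n)"
  have A0: "A \<ge> 0" by (simp add: A_def)
  have "negligible {x. maximal f x = \<infinity>}"
    unfolding negligible_outer_le
  proof (intro allI impI)
    fix e :: real assume e: "e > 0"
    \<comment> \<open>Chosen so that \<open>K * A / t\<close> is at most \<open>e\<close>; the
      summand 1 keeps \<open>t\<close> positive when \<open>A = 0\<close>.\<close>
    define t where "t = (K * A + 1) / e"
    have K0: "K \<ge> 0" by (simp add: K_def)
    have KA: "K * A \<ge> 0" using K0 A0 by simp
    have t: "t > 0" unfolding t_def using KA e by (intro divide_pos_pos) linarith+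
    obtain U where U: "U \<in> lmeasurable"
      "{x. \<exists>a r. 0 < r \<and> x \<in> cube a r \<and>
         r powr (real CARD('n) - 0) * t < (LINT y:cube a r|lebesgue. \<bar>f y\<bar>)} \<subseteq> U"
      "measure lebesgue U \<le> K * (inverse t * A) powr (real CARD('n) / (real CARD('n) - 0))"
      unfolding K_def A_def
      by (rule fractional_maximal_weak_type[OF f, of 0 t]) (use t in auto)
    have "{x. maximal f x = \<infinity>} \<subseteq> U"
    proof
      fix x assume "x \<in> {x. maximal f x = \<infinity>}"
      then have "ennreal t < maximal f x" by simp
      then obtain Q where Q: "Q \<in> cubes" "x \<in> Q"
        "ennreal t < (\<integral>\<^sup>+ y\<in>Q. ennreal \<bar>f y\<bar> \<partial>lebesgue) / emeasure lebesgue Q"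
        unfolding maximal_def less_SUP_iff by blast
      then obtain a r where ar: "Q = cube a r" "0 < r" unfolding cubes_def by blast
      have "t < (LINT y:cube a r|lebesgue. \<bar>f y\<bar>) / r ^ CARD('n)"
        using Q(3) t unfolding ar(1) average_cube[OF f ar(2)] by (simp add: ennreal_less_iff)
      then have "r powr (real CARD('n) - 0) * t < (LINT y:cube a r|lebesgue. \<bar>f y\<bar>)"
        using ar(2) by (simp add: powr_realpow field_simps)
      then show "x \<in> U" using U(2) Q(2) ar by blast
    qed
    moreover have "measure lebesgue U \<le> e"
    proof -
      have "measure lebesgue U \<le> K * (inverse t * A)" using U(3) A0 t by simp
      also have "\<dots> = e * (K * A / (K * A + 1))" by (simp add: t_def field_simps)
      also have "\<dots> \<le> e * 1" using e KA by (intro mult_left_mono) auto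
      finally show ?thesis by simp
    qed
    ultimately show "\<exists>T. {x. maximal f x = \<infinity>} \<subseteq> T \<and> T \<in> lmeasurable \<and> measure lebesgue T \<le> e"
      using U(1) by blast
  qed
  then have "{x. maximal f x = \<infinity>} \<in> null_sets lebesgue"
    by (simp add: negligible_iff_null_sets)
  from AE_not_in[OF this] show ?thesis by (auto simp: less_top)
qed

section \<open>Comparison of maximal functions\<close>

lemma maximal_cong_AE:
  assumes "AE y in lebesgue. u y = v y"
  shows "maximal u x = maximal v x"
  unfolding maximal_def
  by (intro SUP_cong refl arg_cong2[of _ _ _ _ "(/)"] nn_set_integral_cong) (use assms in auto)

lemma maximal_cmult:
  fixes f :: "real ^ 'n \<Rightarrow> real"
  assumes [measurable]: "f \<in> borel_measurable lebesgue" and "0 \<le> c"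
  shows "maximal (\<lambda>y. c * f y) x = ennreal c * maximal f x"
  unfolding maximal_def SUP_mult_left_ennreal
proof (intro SUP_cong refl)
  fix Q assume "Q \<in> {Q \<in> cubes. x \<in> Q}"
  then have [measurable]: "Q \<in> sets lebesgue" unfolding cubes_def by auto
  show "(\<integral>\<^sup>+ y\<in>Q. ennreal \<bar>c * f y\<bar> \<partial>lebesgue) / emeasure lebesgue Q =
      ennreal c * ((\<integral>\<^sup>+ y\<in>Q. ennreal \<bar>f y\<bar> \<partial>lebesgue) / emeasure lebesgue Q)"
    using \<open>0 \<le> c\<close>
    by (simp add: abs_mult ennreal_mult mult.assoc nn_integral_cmult ennreal_times_divide)
qed

text \<open>The pointwise bound is integrated over a cube and divided by its measure before the
  supremum is taken. \<open>L\<close> may vary with the cube, because the oscillation of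
  \<open>b\<close> grows with the side and only its product with the average of
  \<open>\<bar>f\<bar>\<close> is bounded uniformly. Each of the two inequalities for the commutator
  is an instance.\<close>

lemma maximal_le_maximal_plus:
  fixes f u v :: "real ^ 'n \<Rightarrow> real"
  assumes f: "integrable lebesgue f" and v: "v \<in> borel_measurable lebesgue" and c: "0 \<le> c"
    and avg: "\<And>a r. 0 < r \<Longrightarrow> x \<in> cube a r \<Longrightarrow> \<exists>L\<ge>0.
        (\<forall>y\<in>cube a r. \<bar>u y\<bar> \<le> c * \<bar>v y\<bar> + L * \<bar>f y\<bar>) \<and>
        L * ((LINT y:cube a r|lebesgue. \<bar>f y\<bar>) / r ^ CARD('n)) \<le> t"
  shows "maximal u x \<le> ennreal c * maximal v x + ennreal t"
  unfolding maximal_def[of u]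
proof (rule SUP_least)
  fix Q :: "(real ^ 'n) set" assume Q: "Q \<in> {Q \<in> cubes. x \<in> Q}"
  then obtain a r where ar: "Q = cube a r" "0 < r" unfolding cubes_def by blast
  with Q avg obtain L where L: "L \<ge> 0"
    and h: "\<And>y. y \<in> Q \<Longrightarrow> \<bar>u y\<bar> \<le> c * \<bar>v y\<bar> + L * \<bar>f y\<bar>"
    and s: "L * ((LINT y:Q|lebesgue. \<bar>f y\<bar>) / r ^ CARD('n)) \<le> t"
    by blast
  have [measurable]: "f \<in> borel_measurable lebesgue" "v \<in> borel_measurable lebesgue"
      "Q \<in> sets lebesgue"
    using f v ar by auto
  let ?m = "emeasure lebesgue Q"
  have "(\<integral>\<^sup>+ y\<in>Q. ennreal \<bar>u y\<bar> \<partial>lebesgue) \<le>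
      (\<integral>\<^sup>+ y. ennreal c * (ennreal \<bar>v y\<bar> * indicator Q y)
         + ennreal L * (ennreal \<bar>f y\<bar> * indicator Q y) \<partial>lebesgue)"
  proof (intro nn_integral_mono)
    fix y
    show "ennreal \<bar>u y\<bar> * indicator Q y \<le> ennreal c * (ennreal \<bar>v y\<bar> * indicator Q y)
         + ennreal L * (ennreal \<bar>f y\<bar> * indicator Q y)"
    proof (cases "y \<in> Q")
      case True
      then have "ennreal \<bar>u y\<bar> \<le> ennreal (c * \<bar>v y\<bar> + L * \<bar>f y\<bar>)"
        using h by (intro ennreal_leI) auto
      then show ?thesis using True c L by (simp add: ennreal_mult)
    qed simp
  qed
  also have "\<dots> = ennreal c * (\<integral>\<^sup>+ y\<in>Q. ennreal \<bar>v y\<bar> \<partial>lebesgue)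
      + ennreal L * (\<integral>\<^sup>+ y\<in>Q. ennreal \<bar>f y\<bar> \<partial>lebesgue)"
    by (simp add: nn_integral_add nn_integral_cmult)
  finally have "(\<integral>\<^sup>+ y\<in>Q. ennreal \<bar>u y\<bar> \<partial>lebesgue) / ?m \<le>
      ennreal c * ((\<integral>\<^sup>+ y\<in>Q. ennreal \<bar>v y\<bar> \<partial>lebesgue) / ?m)
      + ennreal L * ((\<integral>\<^sup>+ y\<in>Q. ennreal \<bar>f y\<bar> \<partial>lebesgue) / ?m)"
    by (simp add: ennreal_times_divide add_divide_distrib_ennreal[symmetric]
        divide_right_mono_ennreal)
  also have "\<dots> \<le> ennreal c * maximal v x + ennreal t"
  proof (intro add_mono mult_left_mono)
    show "(\<integral>\<^sup>+ y\<in>Q. ennreal \<bar>v y\<bar> \<partial>lebesgue) / ?m \<le> maximal v x"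
      unfolding maximal_def using Q by (rule SUP_upper)
    show "ennreal L * ((\<integral>\<^sup>+ y\<in>Q. ennreal \<bar>f y\<bar> \<partial>lebesgue) / ?m) \<le> ennreal t"
      using s L unfolding ar(1) average_cube[OF f ar(2)]
      by (simp add: ennreal_mult'[symmetric] ennreal_leI)
  qed simp
  finally show "(\<integral>\<^sup>+ y\<in>Q. ennreal \<bar>u y\<bar> \<partial>lebesgue) / ?m
      \<le> ennreal c * maximal v x + ennreal t" .
qed

section \<open>Pointwise bound for the commutator\<close>

lemma Hoelder_imp_continuous_on:
  fixes b :: "'a::real_normed_vector \<Rightarrow> real"
  assumes "\<And>x y. \<bar>b x - b y\<bar> \<le> c * norm (x - y) powr \<beta>" "0 < \<beta>"
  shows "continuous_on UNIV b"
proof -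
  have "(b \<longlongrightarrow> b x) (at x)" for x
  proof (rule Lim_null_comparison[THEN LIM_zero_cancel])
    show "\<forall>\<^sub>F y in at x. norm (b y - b x) \<le> c * norm (y - x) powr \<beta>"
      using assms(1) by simp
    have "((\<lambda>y. norm (y - x)) \<longlongrightarrow> 0) (at x)"
      by (intro tendsto_norm_zero LIM_zero tendsto_ident_at)
    then have "((\<lambda>y. norm (y - x) powr \<beta>) \<longlongrightarrow> 0) (at x)"
      using assms(2) by (intro tendsto_zero_powrI[where b=\<beta>]) auto
    then show "((\<lambda>y. c * norm (y - x) powr \<beta>) \<longlongrightarrow> 0) (at x)"
      by (rule tendsto_mult_right_zero)
  qed
  then show ?thesis by (simp add: continuous_on_def)
qed

text \<open>The assumption \<open>small\<close> says that the fractional maximal function of order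
  \<open>\<beta>\<close> is at most \<open>t / K\<close> at \<open>x\<close>. Replacing
  \<open>b y\<close> by \<open>b x\<close> on a cube then changes the average of
  \<open>\<bar>b y * f y\<bar>\<close> by at most \<open>t\<close>, in either direction.\<close>

lemma commutator_le:
  fixes f b :: "real ^ 'n \<Rightarrow> real"
  assumes f: "integrable lebesgue f"
    and H: "\<And>x y. \<bar>b x - b y\<bar> \<le> c * norm (x - y) powr \<beta>"
    and c: "0 \<le> c" and \<beta>: "0 < \<beta>" and bx: "0 \<le> b x"
    and fin: "maximal f x < \<infinity>"
    and K: "c * real CARD('n) powr \<beta> \<le> K" "0 < K" and t: "0 < t"
    and small: "\<And>a r. 0 < r \<Longrightarrow> x \<in> cube a r \<Longrightarrow>
        (LINT y:cube a r|lebesgue. \<bar>f y\<bar>) \<le> r powr (real CARD('n) - \<beta>) * (t / K)"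
  shows "\<bar>commutator b f x\<bar> \<le> ereal t"
proof -
  \<comment> \<open>Bounds the oscillation of \<open>b\<close> on a cube of side \<open>r\<close>,
    whose diameter is at most \<open>CARD('n) * r\<close>.\<close>
  define L where "L r = c * (real CARD('n) * r) powr \<beta>" for r
  have L0: "L r \<ge> 0" for r using c by (simp add: L_def)
  have osc: "\<bar>b x - b y\<bar> \<le> L r" if "0 < r" "x \<in> cube a r" "y \<in> cube a r" for a r y
  proof -
    have "\<bar>b x - b y\<bar> \<le> c * norm (x - y) powr \<beta>" by (rule H)
    also have "\<dots> \<le> L r" unfolding L_def
      using norm_diff_le_in_cube[OF that(2,3)] c \<beta> by (intro mult_left_mono powr_mono2) auto
    finally show ?thesis .
  qed
  have avg: "L r * ((LINT y:cube a r|lebesgue. \<bar>f y\<bar>) / r ^ CARD('n)) \<le> t"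
    if "0 < r" "x \<in> cube a r" for a r
  proof -
    have "L r * ((LINT y:cube a r|lebesgue. \<bar>f y\<bar>) / r ^ CARD('n))
        \<le> L r * (r powr (real CARD('n) - \<beta>) * (t / K) / r ^ CARD('n))"
      using small[OF that] L0 that by (intro mult_left_mono divide_right_mono) auto
    \<comment> \<open>The powers of \<open>r\<close> cancel: \<open>L r\<close> contributes the
      exponent \<open>\<beta>\<close>, the mass bound \<open>n - \<beta>\<close> and the volume
      \<open>-n\<close>.\<close>
    also have "\<dots> = c * real CARD('n) powr \<beta> * (t / K)"
      using that by (simp add: L_def powr_mult powr_diff powr_realpow field_simps)
    also have "\<dots> \<le> K * (t / K)" using K t by (intro mult_right_mono) auto
    finally show ?thesis using K by simp
  qed
  have [measurable]: "f \<in> borel_measurable lebesgue" using f by auto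
  have "b \<in> borel_measurable borel"
    using Hoelder_imp_continuous_on[OF H \<beta>] by (rule borel_measurable_continuous_onI)
  then have [measurable]: "b \<in> borel_measurable lebesgue"
    by (simp add: measurable_completion)
  have up: "maximal (\<lambda>y. b y * f y) x \<le> ennreal (b x) * maximal f x + ennreal t"
  proof (rule maximal_le_maximal_plus[OF f _ bx])
    fix a r assume r: "0 < r" "x \<in> cube a r"
    have "\<bar>b y * f y\<bar> \<le> b x * \<bar>f y\<bar> + L r * \<bar>f y\<bar>" if "y \<in> cube a r" for y
    proof -
      have "\<bar>b y\<bar> \<le> b x + L r" using osc[OF r that] bx by linarith
      then show ?thesis
        by (simp add: abs_mult distrib_right[symmetric] mult_right_mono)
    qed
    with avg[OF r] L0 show "\<exists>L\<ge>0. (\<forall>y\<in>cube a r. \<bar>b y * f y\<bar> \<le> b x * \<bar>f y\<bar> + L * \<bar>f y\<bar>) \<and>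
        L * ((LINT y:cube a r|lebesgue. \<bar>f y\<bar>) / r ^ CARD('n)) \<le> t" by blast
  qed auto
  \<comment> \<open>Here \<open>b\<close> is frozen at \<open>x\<close>. As \<open>b x\<close> is
    nonnegative, \<open>maximal_cmult\<close> turns the left side into the first term of the
    commutator.\<close>
  have "maximal (\<lambda>y. b x * f y) x \<le> ennreal 1 * maximal (\<lambda>y. b y * f y) x + ennreal t"
  proof (rule maximal_le_maximal_plus[OF f])
    fix a r assume r: "0 < r" "x \<in> cube a r"
    have "\<bar>b x * f y\<bar> \<le> 1 * \<bar>b y * f y\<bar> + L r * \<bar>f y\<bar>" if "y \<in> cube a r" for y
    proof -
      have "\<bar>b x\<bar> \<le> \<bar>b y\<bar> + L r" using osc[OF r that] by linarith
      then show ?thesis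
        by (simp add: abs_mult distrib_right[symmetric] mult_right_mono)
    qed
    with avg[OF r] L0 show "\<exists>L\<ge>0. (\<forall>y\<in>cube a r. \<bar>b x * f y\<bar> \<le> 1 * \<bar>b y * f y\<bar> + L * \<bar>f y\<bar>) \<and>
        L * ((LINT y:cube a r|lebesgue. \<bar>f y\<bar>) / r ^ CARD('n)) \<le> t" by blast
  qed auto
  then have low: "ennreal (b x) * maximal f x \<le> maximal (\<lambda>y. b y * f y) x + ennreal t"
    using bx by (simp add: maximal_cmult)
  \<comment> \<open>Finiteness of \<open>maximal f x\<close> passes to
    \<open>maximal (\<lambda>y. b y * f y) x\<close> through \<open>up\<close>, so the extended
    difference in the commutator is one of real numbers.\<close>
  obtain m where m: "maximal f x = ennreal m" "0 \<le> m"
    using fin by (cases "maximal f x") auto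
  have up': "maximal (\<lambda>y. b y * f y) x \<le> ennreal (b x * m + t)"
    using up m bx t by (simp add: ennreal_mult)
  then obtain k where k: "maximal (\<lambda>y. b y * f y) x = ennreal k" "0 \<le> k"
    by (cases "maximal (\<lambda>y. b y * f y) x") (auto simp: top_unique)
  have "k \<le> b x * m + t"
    using up' k m bx t by (simp add: ennreal_le_iff del: ennreal_plus)
  moreover have "b x * m \<le> k + t"
  proof -
    have "ennreal (b x * m) \<le> ennreal (k + t)" using low m k bx t by (simp add: ennreal_mult)
    then show ?thesis using k t by (subst (asm) ennreal_le_iff) auto
  qed
  ultimately show ?thesis using m k by (simp add: commutator_def abs_le_iff)
qed

section \<open>Weak-type estimate for the commutator\<close>

theorem theorem1p5:
  fixes b :: "real ^ 'n \<Rightarrow> real" and \<beta> :: real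
  assumes "AE x in lebesgue. 0 \<le> b x"
    and "locally_integrable b"
    and "0 < \<beta>" and "\<beta> < 1"
    and "b \<in> lipschitz_space \<beta>"
  shows "\<exists>C::real. C > 0 \<and>
    (\<forall>f :: real ^ 'n \<Rightarrow> real. integrable lebesgue f \<longrightarrow>
      (\<forall>t::real. t > 0 \<longrightarrow>
        emeasure lebesgue {x. \<bar>commutator b f x\<bar> > ereal t}
          \<le> ennreal (C * (inverse t * (LINT x|lebesgue. \<bar>f x\<bar>))
                 powr (real CARD('n) / (real CARD('n) - \<beta>)))))"
proof -
  obtain b' C0 where b': "AE x in lebesgue. b x = b' x"
    and C0: "\<And>x y. \<bar>b' x - b' y\<bar> \<le> C0 * norm (x - y) powr \<beta>"
    using assms(5) unfolding lipschitz_space_def by blast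
  define c where "c = \<bar>C0\<bar>"
  have H: "\<bar>b' x - b' y\<bar> \<le> c * norm (x - y) powr \<beta>" for x y
    using C0[of x y] unfolding c_def
    by (meson abs_ge_self mult_right_mono order_trans powr_ge_zero)
  have c: "0 \<le> c" by (simp add: c_def)
  \<comment> \<open>The summand 1 makes \<open>K\<close> positive even if \<open>c = 0\<close>, so
    that division by \<open>K\<close> is possible.\<close>
  define K where "K = c * real CARD('n) powr \<beta> + 1"
  have K: "c * real CARD('n) powr \<beta> \<le> K" "0 < K"
    using c by (auto simp: K_def add_nonneg_pos)
  define p where "p = real CARD('n) / (real CARD('n) - \<beta>)"
  have \<beta>n: "\<beta> < real CARD('n)"
  proof -
    have "1 \<le> real CARD('n)" by (simp add: Suc_leI)
    then show ?thesis using assms(4) by linarith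
  qed
  \<comment> \<open>The fractional estimate is applied at height \<open>t / K\<close>, which costs
    the factor \<open>K powr p\<close>.\<close>
  define C where "C = (10 * real CARD('n)) ^ CARD('n) * K powr p"
  have "C > 0" using K by (simp add: C_def)
  moreover have "emeasure lebesgue {x. \<bar>commutator b f x\<bar> > ereal t}
      \<le> ennreal (C * (inverse t * (LINT x|lebesgue. \<bar>f x\<bar>)) powr p)"
    if f: "integrable lebesgue f" and t: "0 < t" for f :: "real ^ 'n \<Rightarrow> real" and t
  proof -
    let ?S = "{x. \<exists>a r. 0 < r \<and> x \<in> cube a r \<and>
        r powr (real CARD('n) - \<beta>) * (t / K) < (LINT y:cube a r|lebesgue. \<bar>f y\<bar>)}"
    obtain U where U: "U \<in> lmeasurable" "?S \<subseteq> U"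
      "measure lebesgue U \<le> (10 * real CARD('n)) ^ CARD('n) *
        (inverse (t / K) * (LINT x|lebesgue. \<bar>f x\<bar>)) powr p"
      unfolding p_def
      by (rule fractional_maximal_weak_type[OF f, of \<beta> "t / K"]) (use t K assms(3) \<beta>n in auto)
    \<comment> \<open>This holds at every \<open>x\<close>, since integrals over cubes ignore null
      sets. Only the outer factor \<open>b x\<close> of the commutator needs equality with
      \<open>b' x\<close> at the point itself.\<close>
    have bf: "maximal (\<lambda>y. b y * f y) x = maximal (\<lambda>y. b' y * f y) x" for x
      using b' by (intro maximal_cong_AE) auto
    have "AE x in lebesgue. \<bar>commutator b f x\<bar> > ereal t \<longrightarrow> x \<in> U"
      using assms(1) b' maximal_finite_AE[OF f]
    proof eventually_elim
      case (elim x)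
      show ?case
      proof (rule impI, rule ccontr)
        assume gt: "\<bar>commutator b f x\<bar> > ereal t" and "x \<notin> U"
        then have "x \<notin> ?S" using U(2) by blast
        then have "(LINT y:cube a r|lebesgue. \<bar>f y\<bar>) \<le> r powr (real CARD('n) - \<beta>) * (t / K)"
          if "0 < r" "x \<in> cube a r" for a r
          using that leI by blast
        then have "\<bar>commutator b' f x\<bar> \<le> ereal t"
          using elim by (intro commutator_le[OF f H c assms(3) _ _ K t]) auto
        with gt elim bf show False by (simp add: commutator_def)
      qed
    qed
    then obtain N where N: "{x. \<not> (\<bar>commutator b f x\<bar> > ereal t \<longrightarrow> x \<in> U)} \<subseteq> N"
      "N \<in> null_sets lebesgue"
      by (rule AE_E3) auto
    \<comment> \<open>Monotonicity requires measurability of the larger set only. The inclusion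
      bounds even the outer measure, so the estimate does not rest on the default
      \<open>emeasure\<close> 0 of non-measurable sets.\<close>
    have "emeasure lebesgue {x. \<bar>commutator b f x\<bar> > ereal t} \<le> emeasure lebesgue (U \<union> N)"
      using N U(1) by (intro emeasure_mono) auto
    also have "\<dots> = ennreal (measure lebesgue U)"
      using N U(1) by (simp add: emeasure_Un_null_set fmeasurableD emeasure_eq_measure2)
    also have "\<dots> \<le> ennreal (C * (inverse t * (LINT x|lebesgue. \<bar>f x\<bar>)) powr p)"
    proof (rule ennreal_leI)
      have "(inverse (t / K) * (LINT x|lebesgue. \<bar>f x\<bar>)) powr p
          = (K * (inverse t * (LINT x|lebesgue. \<bar>f x\<bar>))) powr p"
        by (simp add: field_simps)
      also have "\<dots> = K powr p * (inverse t * (LINT x|lebesgue. \<bar>f x\<bar>)) powr p"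
        using K t by (intro powr_mult)
      finally show "measure lebesgue U \<le> C * (inverse t * (LINT x|lebesgue. \<bar>f x\<bar>)) powr p"
        using U(3) by (simp add: C_def mult.assoc)
    qed
    finally show ?thesis .
  qed
  ultimately show ?thesis unfolding p_def by blast
qed

end
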